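(* Let $\mathbb{K}$ be a field, let $G$ be a simple graph on $\ell$ vertices with edge set $E_G$, and let $\psi\colon V_G\to 2^{\mathbb{K}}$ be a map with $\psi(v)$ finite for every vertex $v$. Suppose that $(G,\psi)$ has a weighted elimination ordering $(v_1,\dots,v_\ell)$, and let $x_1,\dots,x_\ell$ be the coordinates corresponding to $v_1,\dots,v_\ell$ respectively. For $1\le k\le\ell$ define $$C_{\ge k}=\{k\}\cup\{i\mid k<i\le\ell\text{ and there exists a path }v_kv_{j_1}v_{j_2}\cdots v_{j_n}v_i\text{ in }G\text{ with }k<j_1<j_2<\dots<j_n<i\}$$ (where $n=0$, i.e. an edge $\{v_k,v_i\}$, is allowed), and $$E_{<k}=\{j\mid 1\le j<k,\ \{v_j,v_k\}\in E_G\}.$$ Then the homogeneous derivations $$\theta_E=\sum_{i=1}^{\ell}x_i\frac{\partial}{\partial x_i}+z\frac{\partial}{\partial z},$$ $$\theta_k=\sum_{i\in C_{\ge k}}\left(\prod_{j\in E_{<k}}(x_j-x_i)\prod_{a\in\psi(v_k)}(x_i-az)\right)\frac{\partial}{\partial x_i}\qquad(1\le k\le\ell)$$ form a basis for the $S$-module $D(\mathcal{A}_{G,\psi})$.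
   Context: Let $V$ be an $(\ell+1)$-dimensional $\mathbb{K}$-vector space with $\{z,x_1,\dots,x_\ell\}$ a basis of $V^*$, where $x_i$ corresponds to the vertex $v_i$. The $\psi$-graphical arrangement is $$\mathcal{A}_{G,\psi}=\{\{z=0\}\}\cup\{\{x_i-x_j=0\}\mid\{v_i,v_j\}\in E_G\}\cup\{\{x_i=az\}\mid1\le i\le\ell,\ a\in\psi(v_i)\},$$ where $\{\alpha=0\}$ denotes the hyperplane $\ker\alpha$ for $\alpha \in V^*$. $S=\mathbb{K}[z,x_1,\dots,x_\ell]$ is the symmetric algebra of $V^*$, $\operatorname{Der}(S)$ is the $S$-module of $\mathbb{K}$-linear derivations $S\to S$, and for an arrangement $\mathcal{A}$, $D(\mathcal{A})=\{\theta\in\operatorname{Der}(S)\mid\theta(\alpha_H)\in\alpha_HS\text{ for all }H\in\mathcal{A}\}$, where $\alpha_H$ is a linear form with kernel $H$. A vertex is simplicial if the subgraph induced by its neighbors is complete. An ordering $(v_1,\dots,v_\ell)$ of the vertices is a weighted elimination ordering of $(G,\psi)$ if each $v_i$ is simplicial in the subgraph induced by $\{v_1,\dots,v_i\}$ and $\psi(v_i)\supseteq\psi(v_j)$ whenever $i<j$ and $\{v_i,v_j\}\in E_G$. *)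

theory Defs
  imports Complex_Main "HOL-Library.Poly_Mapping" "HOL-Library.Function_Algebras"
begin

section \<open>Modules of functions\<close>

text \<open>Pointwise scalar multiplication on functions with values in a commutative ring. Together with
  the pointwise addition of \<^theory>\<open>HOL-Library.Function_Algebras\<close> it serves both for the dual of a
  vector space and for the module of derivations.\<close>

definition fun_scale :: "'r::comm_ring_1 \<Rightarrow> ('b \<Rightarrow> 'r) \<Rightarrow> 'b \<Rightarrow> 'r" where
  "fun_scale r f = (\<lambda>b. r * f b)"

lemma module_fun_scale: "module (fun_scale :: 'r::comm_ring_1 \<Rightarrow> ('b \<Rightarrow> 'r) \<Rightarrow> 'b \<Rightarrow> 'r)"
  by (auto simp: module_def fun_scale_def algebra_simps fun_eq_iff)

definition is_basis_family ::
  "('r::comm_ring_1 \<Rightarrow> 'm::ab_group_add \<Rightarrow> 'm) \<Rightarrow> 'm set \<Rightarrow> 'j set \<Rightarrow> ('j \<Rightarrow> 'm) \<Rightarrow> bool" where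
  "is_basis_family scl M J b \<longleftrightarrow>
     inj_on b J \<and> \<not> module.dependent scl (b ` J) \<and> module.span scl (b ` J) = M"

definition dual_space :: "('k::field \<Rightarrow> 'v::ab_group_add \<Rightarrow> 'v) \<Rightarrow> ('v \<Rightarrow> 'k) set" where
  "dual_space scl = {\<alpha>. Vector_Spaces.linear scl (*) \<alpha>}"


section \<open>The polynomial ring\<close>

text \<open>The polynomial ring over \<open>'k\<close> in the variables indexed by a finite type \<open>'i\<close>.\<close>

type_synonym ('i, 'k) mpoly = "('i \<Rightarrow>\<^sub>0 nat) \<Rightarrow>\<^sub>0 'k"

definition Const :: "'k::field \<Rightarrow> ('i::finite, 'k) mpoly" where
  "Const c = Poly_Mapping.single 0 c"

definition Var :: "'i::finite \<Rightarrow> ('i, 'k::field) mpoly" where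
  "Var i = Poly_Mapping.single (Poly_Mapping.single i 1) 1"

definition poly_scale :: "'k::field \<Rightarrow> ('i::finite, 'k) mpoly \<Rightarrow> ('i, 'k) mpoly" where
  "poly_scale c p = Const c * p"

text \<open>If the variable \<open>i\<close> does not occur in the monomial \<open>m\<close>, the coefficient below is zero and the
  truncated subtraction is harmless.\<close>

definition partial :: "'i::finite \<Rightarrow> ('i, 'k::field) mpoly \<Rightarrow> ('i, 'k) mpoly" where
  "partial i p = (\<Sum>m \<in> Poly_Mapping.keys p.
     Poly_Mapping.single (m - Poly_Mapping.single i 1)
       (of_nat (Poly_Mapping.lookup m i) * Poly_Mapping.lookup p m))"

definition homogeneous :: "nat \<Rightarrow> ('i::finite, 'k::field) mpoly \<Rightarrow> bool" where
  "homogeneous d p \<longleftrightarrow>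
     (\<forall>m \<in> Poly_Mapping.keys p. (\<Sum>i\<in>UNIV. Poly_Mapping.lookup m i) = d)"

definition Der :: "(('i::finite, 'k::field) mpoly \<Rightarrow> ('i, 'k) mpoly) set" where
  "Der = {\<theta>. Vector_Spaces.linear poly_scale poly_scale \<theta> \<and>
             (\<forall>p q. \<theta> (p * q) = p * \<theta> q + q * \<theta> p)}"

text \<open>Homogeneous of polynomial degree \<open>d\<close>, i.e. with coefficients that are homogeneous of
  degree \<open>d\<close>.\<close>

definition homogeneous_derivation ::
  "nat \<Rightarrow> (('i::finite, 'k::field) mpoly \<Rightarrow> ('i, 'k) mpoly) \<Rightarrow> bool" where
  "homogeneous_derivation d \<theta> \<longleftrightarrow> \<theta> \<in> Der \<and>
     (\<exists>f. (\<forall>i. homogeneous d (f i)) \<and> \<theta> = (\<lambda>p. \<Sum>i\<in>UNIV. f i * partial i p))"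


section \<open>Arrangements and logarithmic derivations\<close>

text \<open>Let \<open>u\<close> be a basis of the dual of \<open>V\<close>, indexed by \<open>'i\<close>. The linear form with coefficients \<open>c\<close>
  with respect to \<open>u\<close> occurs as a function on \<open>V\<close> and, the basis element \<open>u i\<close> being identified with
  the variable \<open>i\<close>, as an element of the symmetric algebra.\<close>

definition form :: "('i::finite \<Rightarrow> 'v \<Rightarrow> 'k::field) \<Rightarrow> ('i \<Rightarrow> 'k) \<Rightarrow> 'v \<Rightarrow> 'k" where
  "form u c = (\<lambda>p. \<Sum>i\<in>UNIV. c i * u i p)"

definition form_poly :: "('i::finite \<Rightarrow> 'k::field) \<Rightarrow> ('i, 'k) mpoly" where
  "form_poly c = (\<Sum>i\<in>UNIV. Const (c i) * Var i)"

definition hyperplane :: "('v \<Rightarrow> 'k::field) \<Rightarrow> 'v set" where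
  "hyperplane \<alpha> = {p. \<alpha> p = 0}"

text \<open>A linear form with a given kernel is unique only up to a unit; the condition is required for all
  of them.\<close>

definition log_derivations ::
  "('i::finite \<Rightarrow> 'v \<Rightarrow> 'k::field) \<Rightarrow> 'v set set
     \<Rightarrow> (('i, 'k) mpoly \<Rightarrow> ('i, 'k) mpoly) set" where
  "log_derivations u A = {\<theta> \<in> Der. \<forall>H \<in> A. \<forall>c. hyperplane (form u c) = H \<longrightarrow>
     form_poly c dvd \<theta> (form_poly c)}"


section \<open>Vertex-weighted graphs\<close>

definition simple_graph :: "'a set \<Rightarrow> 'a set set \<Rightarrow> bool" where
  "simple_graph V E \<longleftrightarrow> finite V \<and> (\<forall>e\<in>E. e \<subseteq> V \<and> card e = 2)"

definition induced_edges :: "'a set set \<Rightarrow> 'a set \<Rightarrow> 'a set set" where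
  "induced_edges E W = {e \<in> E. e \<subseteq> W}"

definition complete_graph :: "'a set \<Rightarrow> 'a set set \<Rightarrow> bool" where
  "complete_graph V E \<longleftrightarrow> (\<forall>a\<in>V. \<forall>b\<in>V. a \<noteq> b \<longrightarrow> {a, b} \<in> E)"

definition neighbors :: "'a set set \<Rightarrow> 'a \<Rightarrow> 'a set" where
  "neighbors E a = {b. {a, b} \<in> E}"

definition simplicial :: "'a set set \<Rightarrow> 'a \<Rightarrow> bool" where
  "simplicial E a \<longleftrightarrow> complete_graph (neighbors E a) (induced_edges E (neighbors E a))"

definition graph_path :: "'a set set \<Rightarrow> 'a list \<Rightarrow> bool" where
  "graph_path E vs \<longleftrightarrow> vs \<noteq> [] \<and> distinct vs \<and> successively (\<lambda>a b. {a, b} \<in> E) vs"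

text \<open>The ordering \<open>v 1, ..., v l\<close> of the \<open>l\<close> vertices is given by a function \<open>v\<close> on the natural
  numbers, of which only the values on \<open>{1..l}\<close> matter.\<close>

definition weighted_elimination_ordering ::
  "'a set \<Rightarrow> 'a set set \<Rightarrow> ('a \<Rightarrow> 'k set) \<Rightarrow> nat \<Rightarrow> (nat \<Rightarrow> 'a) \<Rightarrow> bool" where
  "weighted_elimination_ordering V E \<psi> l v \<longleftrightarrow>
     bij_betw v {1..l} V \<and>
     (\<forall>i\<in>{1..l}. simplicial (induced_edges E (v ` {1..i})) (v i)) \<and>
     (\<forall>i\<in>{1..l}. \<forall>j\<in>{1..l}. i < j \<and> {v i, v j} \<in> E \<longrightarrow> \<psi> (v j) \<subseteq> \<psi> (v i))"


section \<open>The arrangement and the derivations\<close>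

text \<open>In the sequel \<open>z\<close> is the index of the distinguished coordinate and \<open>x a\<close> is the index of the
  coordinate corresponding to the vertex \<open>a\<close>; the coordinates themselves are \<open>u z\<close> and \<open>u (x a)\<close> as
  linear forms on the vector space, and \<open>Var z\<close> and \<open>Var (x a)\<close> as elements of the polynomial
  ring.\<close>

definition psi_graphical_arrangement ::
  "'a set \<Rightarrow> 'a set set \<Rightarrow> ('a \<Rightarrow> 'k set) \<Rightarrow> ('i \<Rightarrow> 'v \<Rightarrow> 'k::field) \<Rightarrow> 'i \<Rightarrow> ('a \<Rightarrow> 'i)
     \<Rightarrow> 'v set set" where
  "psi_graphical_arrangement V E \<psi> u z x =
     {hyperplane (u z)} \<union>
     {hyperplane (\<lambda>p. u (x a) p - u (x b) p) | a b. {a, b} \<in> E} \<union>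
     {hyperplane (\<lambda>p. u (x a) p - c * u z p) | a c. a \<in> V \<and> c \<in> \<psi> a}"

definition C_ge :: "'a set set \<Rightarrow> nat \<Rightarrow> (nat \<Rightarrow> 'a) \<Rightarrow> nat \<Rightarrow> nat set" where
  "C_ge E l v k = {k} \<union> {i. k < i \<and> i \<le> l \<and>
     (\<exists>js. sorted_wrt (<) (k # js @ [i]) \<and> graph_path E (map v (k # js @ [i])))}"

definition E_lt :: "'a set set \<Rightarrow> (nat \<Rightarrow> 'a) \<Rightarrow> nat \<Rightarrow> nat set" where
  "E_lt E v k = {j. 1 \<le> j \<and> j < k \<and> {v j, v k} \<in> E}"

definition theta_Euler ::
  "nat \<Rightarrow> (nat \<Rightarrow> 'a) \<Rightarrow> 'i::finite \<Rightarrow> ('a \<Rightarrow> 'i) \<Rightarrow> ('i, 'k::field) mpoly \<Rightarrow> ('i, 'k) mpoly" where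
  "theta_Euler l v z x = (\<lambda>p.
     (\<Sum>i\<in>{1..l}. Var (x (v i)) * partial (x (v i)) p) + Var z * partial z p)"

definition theta ::
  "'a set set \<Rightarrow> ('a \<Rightarrow> 'k set) \<Rightarrow> nat \<Rightarrow> (nat \<Rightarrow> 'a) \<Rightarrow> 'i::finite \<Rightarrow> ('a \<Rightarrow> 'i) \<Rightarrow> nat
     \<Rightarrow> ('i, 'k::field) mpoly \<Rightarrow> ('i, 'k) mpoly" where
  "theta E \<psi> l v z x k = (\<lambda>p. \<Sum>i \<in> C_ge E l v k.
     ((\<Prod>j \<in> E_lt E v k. Var (x (v j)) - Var (x (v i))) *
      (\<Prod>c \<in> \<psi> (v k). Var (x (v i)) - Const c * Var z)) * partial (x (v i)) p)"

end

theory Submission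
  imports Defs
begin

text \<open>
  The idea is that the derivations are triangular. Number the coordinates so that \<open>z\<close> has number
  \<open>0\<close> and \<open>x\<^sub>k\<close> has number \<open>k\<close>, and let \<open>\<theta>\<^sub>0\<close> be the Euler derivation. The set
  \<open>C\<^sub>\<ge>\<^sub>k\<close> contains only indices that are at least \<open>k\<close>, so \<open>\<theta>\<^sub>k\<close> kills all coordinates
  of smaller number, and its leading value
  \<open>\<theta>\<^sub>k(x\<^sub>k) = (\<Prod>j\<in>E\<^sub><\<^sub>k. x\<^sub>j - x\<^sub>k) (\<Prod>a\<in>\<psi>(v\<^sub>k). x\<^sub>k - a z)\<close> is nonzero in a ring without zero
  divisors. This gives linear independence.

  For generation, let \<open>\<theta>\<close> be a logarithmic derivation that kills the coordinates with numbers
  below \<open>k\<close>. The conditions at the hyperplanes \<open>x\<^sub>j = x\<^sub>k\<close>, \<open>j \<in> E\<^sub><\<^sub>k\<close>, and \<open>x\<^sub>k = a z\<close> then say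
  that \<open>\<theta>(x\<^sub>k)\<close> itself is divisible by the corresponding linear forms. Up to sign these are
  \<open>x\<^sub>k - t\<close> for pairwise different \<open>t\<close> not involving \<open>x\<^sub>k\<close>, so the factor theorem
  (\<open>prod_root_factors_dvd\<close>) makes their product \<open>\<theta>\<^sub>k(x\<^sub>k)\<close> divide \<open>\<theta>(x\<^sub>k)\<close>. Subtracting a
  multiple of \<open>\<theta>\<^sub>k\<close> kills one more coordinate, and a derivation that kills all coordinates is
  zero. The elimination is carried out for arbitrary triangular families in
  \<open>triangular_is_basis_family\<close>.

  The ordering is what makes the \<open>\<theta>\<^sub>k\<close> logarithmic. Weights can only shrink along increasing paths,
  so for \<open>i \<in> C\<^sub>\<ge>\<^sub>k\<close> every \<open>a \<in> \<psi>(v\<^sub>i)\<close> lies in \<open>\<psi>(v\<^sub>k)\<close> and contributes a factor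
  \<open>x\<^sub>i - a z\<close> to \<open>\<theta>\<^sub>k(x\<^sub>i)\<close>. For an edge between \<open>i < j\<close> there are three cases. If both
  indices lie in \<open>C\<^sub>\<ge>\<^sub>k\<close>, the two values of \<open>\<theta>\<^sub>k\<close> arise from one polynomial by inserting \<open>x\<^sub>i\<close> and
  \<open>x\<^sub>j\<close>. If neither does, both values vanish. Since \<open>C\<^sub>\<ge>\<^sub>k\<close> is closed under going up an edge, only
  \<open>i \<notin> C\<^sub>\<ge>\<^sub>k\<close>, \<open>j \<in> C\<^sub>\<ge>\<^sub>k\<close> remains; walking from \<open>j\<close> back to \<open>k\<close> along the path and using
  that earlier neighbours of a vertex are adjacent, one finds that \<open>i\<close> is adjacent to all
  vertices of the path, whence \<open>i \<in> E\<^sub><\<^sub>k\<close> (\<open>outside_neighbor_in_E_lt\<close>), and \<open>x\<^sub>i - x\<^sub>j\<close> is a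
  factor of \<open>\<theta>\<^sub>k(x\<^sub>j)\<close>.
\<close>


section \<open>Additive and multiplicative maps on the polynomial ring\<close>

text \<open>Substitutions, partial derivatives and changes of the monomial monoid are all given by a
  rule for single terms, extended additively. The rule takes the coefficient as an argument, so
  that it may be additive in it without being a scalar multiplication.\<close>

definition monomialwise ::
  "('m \<Rightarrow> 'k \<Rightarrow> 'r) \<Rightarrow> ('m \<Rightarrow>\<^sub>0 'k::zero) \<Rightarrow> 'r::comm_monoid_add" where
  "monomialwise h p = (\<Sum>m\<in>Poly_Mapping.keys p. h m (Poly_Mapping.lookup p m))"

lemma monomialwise_zero [simp]: "monomialwise h 0 = 0"
  by (simp add: monomialwise_def)

lemma monomialwise_single:
  assumes "\<And>m. h m 0 = 0"
  shows "monomialwise h (Poly_Mapping.single m c) = h m c"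
  by (cases "c = 0") (simp_all add: monomialwise_def assms)

lemma monomialwise_add:
  fixes h :: "'m \<Rightarrow> 'k::comm_monoid_add \<Rightarrow> 'r::comm_monoid_add"
  assumes "\<And>m. h m 0 = 0" "\<And>m c d. h m (c + d) = h m c + h m d"
  shows "monomialwise h (p + q) = monomialwise h p + monomialwise h q"
  unfolding monomialwise_def by (rule setsum_keys_plus_distrib) (simp_all add: assms)

lemma poly_mapping_induct_single [case_names zero single add]:
  fixes p :: "'m \<Rightarrow>\<^sub>0 'k::comm_monoid_add"
  assumes "P 0" "\<And>m c. P (Poly_Mapping.single m c)" "\<And>p q. P p \<Longrightarrow> P q \<Longrightarrow> P (p + q)"
  shows "P p"
proof -
  have "P (\<Sum>m\<in>A. Poly_Mapping.single m (Poly_Mapping.lookup p m))" if "finite A" for A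
    using that by (induction A rule: finite_induct) (auto intro: assms)
  moreover have "(\<Sum>m\<in>Poly_Mapping.keys p. Poly_Mapping.single m (Poly_Mapping.lookup p m)) = p"
    by (rule poly_mapping_eqI)
      (auto simp: lookup_sum lookup_single when_def not_in_keys_iff_lookup_eq_zero)
  ultimately show ?thesis by (metis finite_keys)
qed

lemma monomialwise_mult:
  fixes h :: "'m::comm_monoid_add \<Rightarrow> 'k::comm_semiring_0 \<Rightarrow> 'r::comm_semiring_0"
  assumes zero: "\<And>m. h m 0 = 0" and add: "\<And>m c d. h m (c + d) = h m c + h m d"
    and mult: "\<And>m n c d. h (m + n) (c * d) = h m c * h n d"
  shows "monomialwise h (p * q) = monomialwise h p * monomialwise h q"
proof -
  note hom = monomialwise_single[of h, OF zero] monomialwise_add[of h, OF zero add]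
  show ?thesis
  proof (induction p rule: poly_mapping_induct_single)
    case (single m c)
    show ?case
      by (induction q rule: poly_mapping_induct_single)
        (simp_all add: hom mult_single mult algebra_simps)
  qed (simp_all add: hom algebra_simps)
qed

lemma Const_0 [simp]: "Const 0 = 0"
  and Const_1 [simp]: "Const 1 = 1"
  by (simp_all add: Const_def)

lemma Const_add: "Const (a + b) = Const a + Const b"
  and Const_diff: "Const (a - b) = Const a - Const b"
  and Const_mult: "Const (a * b) = Const a * Const b"
  by (simp_all add: Const_def single_add single_diff mult_single)

lemma Const_inject [simp]: "Const a = Const b \<longleftrightarrow> a = b"
  unfolding Const_def by (metis lookup_single_eq)

lemma single_eq_monomial:
  fixes m :: "'i::finite \<Rightarrow>\<^sub>0 nat" and c :: "'k::field"
  shows "Poly_Mapping.single m c = Const c * (\<Prod>i\<in>UNIV. Var i ^ Poly_Mapping.lookup m i)"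
proof -
  have pow: "Var i ^ n = Poly_Mapping.single (Poly_Mapping.single i n) (1::'k)" for i :: 'i and n
    by (induction n) (simp_all add: Var_def mult_single flip: single_add)
  have "(\<Prod>i\<in>A. Var i ^ Poly_Mapping.lookup m i) =
      Poly_Mapping.single (\<Sum>i\<in>A. Poly_Mapping.single i (Poly_Mapping.lookup m i)) (1::'k)"
    if "finite A" for A
    using that by (induction A rule: finite_induct) (simp_all add: pow mult_single)
  moreover have "(\<Sum>i\<in>UNIV. Poly_Mapping.single i (Poly_Mapping.lookup m i)) = m"
    by (rule poly_mapping_eqI) (simp add: lookup_sum lookup_single when_def)
  ultimately show ?thesis by (simp add: Const_def mult_single)
qed

text \<open>Reduces every identity between ring homomorphisms or derivations to constants and
  variables.\<close>

lemma mpoly_induct [case_names Const Var add mult]: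
  fixes p :: "('i::finite, 'k::field) mpoly"
  assumes Const: "\<And>c. P (Const c)" and Var: "\<And>i. P (Var i)"
    and add: "\<And>p q. P p \<Longrightarrow> P q \<Longrightarrow> P (p + q)" and mult: "\<And>p q. P p \<Longrightarrow> P q \<Longrightarrow> P (p * q)"
  shows "P p"
proof -
  have P1: "P 1" using Const[of 1] by simp
  have pow: "P (Var i ^ n)" for i n
    by (induction n) (auto intro: P1 Var mult)
  have "P (\<Prod>i\<in>A. Var i ^ Poly_Mapping.lookup m i)" if "finite A" for A m
    using that by (induction A rule: finite_induct) (auto intro: P1 mult pow)
  then show ?thesis
    by (induction p rule: poly_mapping_induct_single)
      (use Const[of 0] in \<open>auto simp: single_eq_monomial intro: Const add mult\<close>)
qed


section \<open>Absence of zero divisors\<close>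

text \<open>The ring of polynomials over a linearly ordered set of variables has no zero divisors, by
  comparison of leading terms. An arbitrary finite index type carries no order, but numbering it
  by natural numbers embeds the polynomial ring into one where the result applies.\<close>

definition index :: "'i::finite \<Rightarrow> nat" where
  "index = (SOME f. inj f)"

lemma inj_index: "inj (index :: 'i::finite \<Rightarrow> nat)"
  unfolding index_def using finite_imp_inj_to_nat_seg[of "UNIV :: 'i set"]
  by (metis finite_class.finite_UNIV someI)

definition ordered_monomial :: "('i::finite \<Rightarrow>\<^sub>0 nat) \<Rightarrow> (nat \<Rightarrow>\<^sub>0 nat)" where
  "ordered_monomial m = (\<Sum>i\<in>UNIV. Poly_Mapping.single (index i) (Poly_Mapping.lookup m i))"

lemma lookup_ordered_monomial:
  "Poly_Mapping.lookup (ordered_monomial m) (index i) = Poly_Mapping.lookup m i"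
  by (simp add: ordered_monomial_def lookup_sum lookup_single when_def inj_eq[OF inj_index])

lemma ordered_monomial_add: "ordered_monomial (m + n) = ordered_monomial m + ordered_monomial n"
  by (simp add: ordered_monomial_def lookup_add single_add sum.distrib)

lemma inj_ordered_monomial: "inj ordered_monomial"
  by (rule injI) (metis lookup_ordered_monomial poly_mapping_eqI)

text \<open>Renaming the monomials is an injective ring homomorphism, since the coefficient of the image
  at a renamed monomial is the original coefficient.\<close>

lemma mpoly_no_zero_divisors:
  fixes p q :: "('i::finite, 'k::field) mpoly"
  assumes "p * q = 0"
  shows "p = 0 \<or> q = 0"
proof -
  let ?h = "\<lambda>(m :: 'i \<Rightarrow>\<^sub>0 nat) (c::'k). Poly_Mapping.single (ordered_monomial m) c"
  have kernel: "r = 0" if "monomialwise ?h r = 0" for r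
  proof (rule poly_mapping_eqI)
    fix m
    have "Poly_Mapping.lookup (monomialwise ?h r) (ordered_monomial m) = Poly_Mapping.lookup r m"
      by (auto simp: monomialwise_def lookup_sum lookup_single when_def
          inj_eq[OF inj_ordered_monomial] not_in_keys_iff_lookup_eq_zero)
    then show "Poly_Mapping.lookup r m = Poly_Mapping.lookup 0 m" using that by simp
  qed
  have "monomialwise ?h p * monomialwise ?h q = monomialwise ?h (p * q)"
    by (rule monomialwise_mult[symmetric]) (simp_all add: single_add ordered_monomial_add mult_single)
  then show ?thesis using assms kernel by auto
qed

lemma mpoly_prod_nonzero:
  fixes f :: "'b \<Rightarrow> ('i::finite, 'k::field) mpoly"
  assumes "\<And>a. a \<in> A \<Longrightarrow> f a \<noteq> 0"
  shows "prod f A \<noteq> 0"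
  using assms by (induction A rule: infinite_finite_induct) (auto dest: mpoly_no_zero_divisors)


section \<open>Roots of a polynomial with respect to one variable\<close>

definition substitute ::
  "'i \<Rightarrow> ('i::finite, 'k::field) mpoly \<Rightarrow> ('i, 'k) mpoly \<Rightarrow> ('i, 'k) mpoly" where
  "substitute k s = monomialwise
     (\<lambda>m c. Const c * (\<Prod>i\<in>UNIV. (if i = k then s else Var i) ^ Poly_Mapping.lookup m i))"

lemma substitute_add: "substitute k s (p + q) = substitute k s p + substitute k s q"
  unfolding substitute_def by (rule monomialwise_add) (simp_all add: Const_add algebra_simps)

lemma substitute_mult: "substitute k s (p * q) = substitute k s p * substitute k s q"
  unfolding substitute_def
  by (rule monomialwise_mult)
    (simp_all add: Const_add Const_mult lookup_add power_add prod.distrib algebra_simps)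

lemma substitute_Const [simp]: "substitute k s (Const c) = Const c"
  unfolding substitute_def by (subst Const_def, subst monomialwise_single) simp_all

lemma substitute_Var: "substitute k s (Var j) = (if j = k then s else Var j)"
proof -
  have "(\<Prod>i\<in>UNIV. (if i = k then s else Var i) ^ Poly_Mapping.lookup (Poly_Mapping.single j 1) i) =
      (\<Prod>i\<in>UNIV. if i = j then (if i = k then s else Var i) else 1)"
    by (rule prod.cong) (auto simp: lookup_single when_def)
  then show ?thesis
    unfolding substitute_def by (subst Var_def, subst monomialwise_single) simp_all
qed

lemma substitute_diff: "substitute k s (p - q) = substitute k s p - substitute k s q"
  by (metis add_diff_cancel_right' diff_add_cancel substitute_add)

lemma substitute_prod: "substitute k s (prod f A) = (\<Prod>a\<in>A. substitute k s (f a))"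
  using substitute_Const[of k s 1]
  by (induction A rule: infinite_finite_induct) (simp_all add: substitute_mult)

lemma root_factor_dvd_diff_substitute: "Var k - s dvd p - substitute k s p"
proof (induction p rule: mpoly_induct)
  case (add p q)
  then have "Var k - s dvd (p - substitute k s p) + (q - substitute k s q)" by (rule dvd_add)
  then show ?case by (simp add: substitute_add algebra_simps)
next
  case (mult p q)
  then have "Var k - s dvd q * (p - substitute k s p) + substitute k s p * (q - substitute k s q)"
    by (intro dvd_add dvd_mult)
  then show ?case by (simp add: substitute_mult algebra_simps)
qed (simp_all add: substitute_Var)

text \<open>The factor theorem; the hypothesis holds whenever \<open>s\<close> does not involve the
  variable \<open>k\<close>.\<close>

lemma root_factor_dvd_iff:
  assumes "substitute k s s = s"
  shows "Var k - s dvd p \<longleftrightarrow> substitute k s p = 0"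
proof
  assume "Var k - s dvd p"
  then obtain g where "p = (Var k - s) * g" by (rule dvdE)
  then show "substitute k s p = 0"
    using assms by (simp add: substitute_mult substitute_diff substitute_Var)
next
  assume "substitute k s p = 0"
  then show "Var k - s dvd p" using root_factor_dvd_diff_substitute[of k s p] by simp
qed

text \<open>Once the factors with roots in \<open>T\<close> have been split off, inserting a further root \<open>s\<close> leaves
  the product of the nonzero differences \<open>s - t\<close>, which can be cancelled; so \<open>s\<close> is a root of the
  cofactor. This replaces unique factorization.\<close>

lemma prod_root_factors_dvd:
  assumes "finite T" and free: "\<And>s t. s \<in> T \<Longrightarrow> t \<in> T \<Longrightarrow> substitute k s t = t"
    and "\<And>t. t \<in> T \<Longrightarrow> Var k - t dvd p"
  shows "(\<Prod>t\<in>T. Var k - t) dvd p"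
  using assms
proof (induction T rule: finite_induct)
  case (insert s T)
  then have "(\<Prod>t\<in>T. Var k - t) dvd p" by blast
  then obtain g where g: "p = (\<Prod>t\<in>T. Var k - t) * g" by (rule dvdE)
  have subst: "substitute k s t = t" if "t \<in> insert s T" for t
    using insert.prems(1) that by blast
  have "0 = substitute k s p"
    using insert.prems(2)[of s] subst[of s] by (simp add: root_factor_dvd_iff)
  also have "\<dots> = (\<Prod>t\<in>T. s - t) * substitute k s g"
    using subst by (simp add: g substitute_mult substitute_prod substitute_diff substitute_Var)
  finally have "(\<Prod>t\<in>T. s - t) = 0 \<or> substitute k s g = 0"
    using mpoly_no_zero_divisors by metis
  moreover have "(\<Prod>t\<in>T. s - t) \<noteq> 0"
    using insert.hyps by (intro mpoly_prod_nonzero) auto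
  ultimately have "Var k - s dvd g" using subst[of s] by (simp add: root_factor_dvd_iff)
  then show ?case using insert.hyps by (simp add: g mult.commute mult_dvd_mono)
qed simp


section \<open>Derivations of the polynomial ring\<close>

lemma partial_eq_monomialwise:
  "partial i = monomialwise (\<lambda>m c.
     Poly_Mapping.single (m - Poly_Mapping.single i 1) (of_nat (Poly_Mapping.lookup m i) * c))"
  by (simp add: fun_eq_iff partial_def monomialwise_def)

lemma partial_single:
  "partial i (Poly_Mapping.single m c) =
     Poly_Mapping.single (m - Poly_Mapping.single i 1) (of_nat (Poly_Mapping.lookup m i) * c)"
  by (simp add: partial_eq_monomialwise monomialwise_single)

lemma partial_add: "partial i (p + q) = partial i p + partial i q"
  unfolding partial_eq_monomialwise
  by (rule monomialwise_add) (simp_all add: single_add[symmetric] algebra_simps)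

lemma partial_Const [simp]: "partial i (Const c) = 0"
  by (simp add: Const_def partial_single)

lemma partial_Var: "partial i (Var j) = (if i = j then 1 else 0)"
  by (simp add: Var_def partial_single lookup_single when_def)

lemma partial_mult: "partial i (p * q) = p * partial i q + q * partial i p"
proof -
  \<comment> \<open>Where the truncated subtraction of exponents fails to associate, the coefficient is zero.\<close>
  have shift: "Poly_Mapping.single (m + (n - Poly_Mapping.single i 1)) (of_nat (Poly_Mapping.lookup n i) * c) =
      Poly_Mapping.single (m + n - Poly_Mapping.single i 1) (of_nat (Poly_Mapping.lookup n i) * c)"
    for m n :: "'a \<Rightarrow>\<^sub>0 nat" and c :: 'b
  proof (cases "Poly_Mapping.lookup n i = 0")
    case False
    then have "m + (n - Poly_Mapping.single i 1) = m + n - Poly_Mapping.single i 1"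
      by (intro poly_mapping_eqI) (auto simp: lookup_add lookup_minus lookup_single when_def)
    then show ?thesis by simp
  qed simp
  have singles: "partial i (Poly_Mapping.single m c * Poly_Mapping.single n d) =
      Poly_Mapping.single m c * partial i (Poly_Mapping.single n d) +
      Poly_Mapping.single n d * partial i (Poly_Mapping.single m c)" for m n and c d :: 'b
  proof -
    have "Poly_Mapping.single m c * partial i (Poly_Mapping.single n d) =
        Poly_Mapping.single (m + n - Poly_Mapping.single i 1) (of_nat (Poly_Mapping.lookup n i) * (c * d))"
      using shift[of m n "c * d"] by (simp add: partial_single mult_single ac_simps)
    moreover have "Poly_Mapping.single n d * partial i (Poly_Mapping.single m c) =
        Poly_Mapping.single (m + n - Poly_Mapping.single i 1) (of_nat (Poly_Mapping.lookup m i) * (c * d))"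
      using shift[of n m "c * d"] by (simp add: partial_single mult_single ac_simps)
    ultimately show ?thesis
      by (simp add: partial_single mult_single lookup_add algebra_simps flip: single_add)
  qed
  have zero: "partial i 0 = 0" by (simp add: partial_eq_monomialwise)
  show ?thesis
  proof (induction p rule: poly_mapping_induct_single)
    case (single m c)
    show ?case
      by (induction q rule: poly_mapping_induct_single)
        (simp_all add: zero singles partial_add algebra_simps)
  qed (simp_all add: zero partial_add algebra_simps)
qed

lemma Var_nonzero: "Var i \<noteq> 0"
  unfolding Var_def by (metis lookup_single_eq lookup_zero zero_neq_one)

text \<open>Partial derivatives tell the linear forms apart that occur as roots in the product
  formula for the basis derivations.\<close>

lemma Var_eq_iff [simp]: "Var a = (Var b :: ('i::finite, 'k::field) mpoly) \<longleftrightarrow> a = b"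
proof
  assume "Var a = (Var b :: ('i, 'k) mpoly)"
  then have "partial a (Var a) = (partial a (Var b) :: ('i, 'k) mpoly)" by simp
  then show "a = b" by (simp add: partial_Var split: if_splits)
qed simp

lemma Var_neq_Const_mult_Var: "a \<noteq> b \<Longrightarrow> Var a \<noteq> Const c * Var b"
proof
  assume "a \<noteq> b" "Var a = Const c * Var b"
  then have "partial a (Var a) = partial a (Const c * Var b)" by simp
  with \<open>a \<noteq> b\<close> show False by (simp add: partial_Var partial_mult)
qed

lemma Const_mult_Var_eq_iff: "Const c * Var b = Const d * Var b \<longleftrightarrow> c = d"
proof
  assume "Const c * Var b = Const d * Var b"
  then have "partial b (Const c * Var b) = partial b (Const d * Var b)" by simp
  then show "c = d" by (simp add: partial_Var partial_mult)
qed simp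

lemma vector_space_poly_scale: "vector_space poly_scale"
  by unfold_locales (simp_all add: poly_scale_def Const_add Const_mult algebra_simps)

lemma Der_iff:
  "\<theta> \<in> Der \<longleftrightarrow> (\<forall>p q. \<theta> (p + q) = \<theta> p + \<theta> q) \<and> (\<forall>c p. \<theta> (Const c * p) = Const c * \<theta> p) \<and>
     (\<forall>p q. \<theta> (p * q) = p * \<theta> q + q * \<theta> p)"
  using vector_space_poly_scale by (auto simp: Der_def Vector_Spaces.linear_iff poly_scale_def)

lemma derivation_Const:
  assumes "\<theta> \<in> Der"
  shows "\<theta> (Const c) = 0"
proof -
  have "\<theta> (1 * 1) = 1 * \<theta> 1 + 1 * \<theta> 1" using assms unfolding Der_iff by blast
  then have "\<theta> 1 = 0" by simp
  moreover have "\<theta> (Const c * 1) = Const c * \<theta> 1" using assms unfolding Der_iff by blast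
  ultimately show ?thesis by simp
qed

lemma derivation_diff:
  assumes "\<theta> \<in> Der"
  shows "\<theta> (p - q) = \<theta> p - \<theta> q"
proof -
  have "\<theta> (p - q + q) = \<theta> (p - q) + \<theta> q" using assms unfolding Der_iff by blast
  then show ?thesis by simp
qed

lemma derivation_eqI:
  assumes "\<theta> \<in> Der" "\<eta> \<in> Der" "\<And>i. \<theta> (Var i) = \<eta> (Var i)"
  shows "\<theta> = \<eta>"
proof
  fix p show "\<theta> p = \<eta> p"
    by (induction p rule: mpoly_induct)
      (use assms in \<open>simp_all add: derivation_Const, simp_all add: Der_iff\<close>)
qed

lemma sum_partial_in_Der: "(\<lambda>p. \<Sum>i\<in>A. f i * partial (w i) p) \<in> Der"
  by (simp add: Der_iff partial_add partial_mult sum.distrib sum_distrib_left algebra_simps)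

lemma Der_closed_add:
  assumes "\<theta> \<in> Der" "\<eta> \<in> Der"
  shows "\<theta> + \<eta> \<in> Der"
  using assms derivation_Const[OF assms(1)] derivation_Const[OF assms(2)]
  by (simp add: Der_iff algebra_simps)

lemma Der_closed_scale:
  assumes "\<theta> \<in> Der"
  shows "fun_scale f \<theta> \<in> Der"
  using assms derivation_Const[OF assms] by (simp add: Der_iff fun_scale_def algebra_simps)

lemma Der_zero: "0 \<in> Der"
  by (simp add: Der_iff)

section \<open>Homogeneous polynomials\<close>

lemma homogeneous_0 [simp]: "homogeneous d 0"
  by (simp add: homogeneous_def)

lemma homogeneous_Const: "homogeneous 0 (Const c)"
  by (simp add: homogeneous_def Const_def)

lemma homogeneous_Var: "homogeneous 1 (Var i)"
  by (simp add: homogeneous_def Var_def lookup_single when_def)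

lemma homogeneous_diff:
  assumes "homogeneous d p" "homogeneous d q"
  shows "homogeneous d (p - q)"
  unfolding homogeneous_def
proof
  fix m assume "m \<in> Poly_Mapping.keys (p - q)"
  then have "m \<in> Poly_Mapping.keys p \<or> m \<in> Poly_Mapping.keys q"
    by (auto simp: in_keys_iff lookup_minus)
  then show "(\<Sum>i\<in>UNIV. Poly_Mapping.lookup m i) = d"
    using assms unfolding homogeneous_def by blast
qed

lemma homogeneous_mult:
  assumes "homogeneous d p" "homogeneous e q"
  shows "homogeneous (d + e) (p * q)"
  unfolding homogeneous_def
proof
  fix m assume "m \<in> Poly_Mapping.keys (p * q)"
  then obtain a b where "m = a + b" "a \<in> Poly_Mapping.keys p" "b \<in> Poly_Mapping.keys q"
    using keys_mult[of p q] by blast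
  then show "(\<Sum>i\<in>UNIV. Poly_Mapping.lookup m i) = d + e"
    using assms by (simp add: homogeneous_def lookup_add sum.distrib)
qed

lemma homogeneous_Const_mult_Var: "homogeneous 1 (Const c * Var i)"
  using homogeneous_mult[OF homogeneous_Const homogeneous_Var, of c i] by simp

lemma homogeneous_prod_linear:
  assumes "\<And>a. a \<in> A \<Longrightarrow> homogeneous 1 (f a)"
  shows "homogeneous (card A) (prod f A)"
  using assms
proof (induction A rule: infinite_finite_induct)
  case (insert a A)
  then have "homogeneous (1 + card A) (f a * prod f A)" by (intro homogeneous_mult) auto
  with insert.hyps show ?case by simp
qed (use homogeneous_Const[of 1] in simp_all)


lemma diff_dvd_commute: "a - b dvd p \<longleftrightarrow> b - a dvd (p :: 'r::comm_ring_1)"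
  by (metis minus_diff_eq minus_dvd_iff)

text \<open>Congruences modulo \<open>d\<close> may be multiplied.\<close>

lemma dvd_prod_diff:
  fixes f g :: "'b \<Rightarrow> 'r::comm_ring_1"
  assumes "\<And>a. a \<in> A \<Longrightarrow> d dvd f a - g a"
  shows "d dvd prod f A - prod g A"
  using assms
proof (induction A rule: infinite_finite_induct)
  case (insert a A)
  then have "d dvd f a * (prod f A - prod g A) + (f a - g a) * prod g A"
    by (intro dvd_add dvd_mult dvd_mult2) auto
  with insert.hyps show ?case by (simp add: algebra_simps)
qed simp_all

section \<open>Bases of modules of functions\<close>

lemma sum_fun_scale_apply: "(\<Sum>k\<in>A. fun_scale (c k) (b k)) p = (\<Sum>k\<in>A. c k * b k p)"
  by (induction A rule: infinite_finite_induct) (simp_all add: fun_scale_def)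

text \<open>A relation among the members of the family, counted by their indices, also detects
  repetitions, so its triviality covers injectivity and independence of the image at once.\<close>

lemma is_basis_familyI:
  fixes scl :: "'r::comm_ring_1 \<Rightarrow> 'm::ab_group_add \<Rightarrow> 'm" and b :: "'j \<Rightarrow> 'm"
  assumes "module scl" "finite J" "module.span scl (b ` J) = M"
    and indep: "\<And>c j. (\<Sum>k\<in>J. scl (c k) (b k)) = 0 \<Longrightarrow> j \<in> J \<Longrightarrow> c j = 0"
  shows "is_basis_family scl M J b"
proof -
  interpret module scl by fact
  have inj: "inj_on b J"
  proof (rule inj_onI, rule ccontr)
    fix i j assume ij: "i \<in> J" "j \<in> J" "b i = b j" "i \<noteq> j"
    \<comment> \<open>Two equal members would give the relation \<open>b i - b j = 0\<close> with coefficient \<open>1\<close> at \<open>i\<close>.\<close>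
    define c :: "'j \<Rightarrow> 'r" where "c k = (if k = i then 1 else if k = j then - 1 else 0)" for k
    have "(\<Sum>k\<in>J. scl (c k) (b k)) =
        (\<Sum>k\<in>J. (if k = i then b i else 0) - (if k = j then b j else 0))"
      using \<open>i \<noteq> j\<close> by (intro sum.cong) (auto simp: c_def)
    also have "\<dots> = 0" using ij \<open>finite J\<close> by (simp add: sum_subtractf)
    finally have "c i = 0" using \<open>i \<in> J\<close> by (rule indep)
    then show False by (simp add: c_def)
  qed
  have "independent (b ` J)"
  proof
    assume "dependent (b ` J)"
    then obtain g where g: "\<exists>m\<in>b ` J. g m \<noteq> 0" "(\<Sum>m\<in>b ` J. scl (g m) m) = 0"
      using \<open>finite J\<close> by (auto simp: dependent_finite)
    from g(2) have "(\<Sum>k\<in>J. scl (g (b k)) (b k)) = 0" by (simp add: sum.reindex[OF inj])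
    then show False using g(1) indep[of "\<lambda>k. g (b k)"] by blast
  qed
  with inj assms(3) show ?thesis by (simp add: is_basis_family_def)
qed

text \<open>Gaussian elimination over a ring. The test points \<open>w j\<close> serve as coordinates on \<open>M\<close>. A
  pivot \<open>b k (w k)\<close> is in general no unit, so that \<open>M\<close> could be too large for the family to
  generate it; assumption \<open>leading\<close> says that each coordinate to be cleared is a multiple of its
  pivot.\<close>

lemma triangular_is_basis_family:
  fixes b :: "nat \<Rightarrow> 'b \<Rightarrow> 'r::comm_ring_1" and w :: "nat \<Rightarrow> 'b"
  assumes sub: "module.subspace fun_scale M"
    and mem: "\<And>k. k \<le> l \<Longrightarrow> b k \<in> M"
    and triangular: "\<And>j k. j < k \<Longrightarrow> k \<le> l \<Longrightarrow> b k (w j) = 0"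
    and regular: "\<And>k g. k \<le> l \<Longrightarrow> g * b k (w k) = 0 \<Longrightarrow> g = 0"
    and leading: "\<And>k \<theta>. k \<le> l \<Longrightarrow> \<theta> \<in> M \<Longrightarrow> (\<And>j. j < k \<Longrightarrow> \<theta> (w j) = 0) \<Longrightarrow> b k (w k) dvd \<theta> (w k)"
    and determined: "\<And>\<theta>. \<theta> \<in> M \<Longrightarrow> (\<And>j. j \<le> l \<Longrightarrow> \<theta> (w j) = 0) \<Longrightarrow> \<theta> = 0"
  shows "is_basis_family fun_scale M {0..l} b"
proof (rule is_basis_familyI)
  show "module (fun_scale :: 'r \<Rightarrow> ('b \<Rightarrow> 'r) \<Rightarrow> 'b \<Rightarrow> 'r)" by (rule module_fun_scale)
  then interpret module "fun_scale :: 'r \<Rightarrow> ('b \<Rightarrow> 'r) \<Rightarrow> 'b \<Rightarrow> 'r" .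
  have in_span: "\<theta> \<in> span (b ` {0..l})"
    if "n \<le> Suc l" "\<theta> \<in> M" "\<And>j. j < n \<Longrightarrow> \<theta> (w j) = 0" for n \<theta>
    using that
  proof (induction n arbitrary: \<theta> rule: inc_induct)
    case base
    then have "\<theta> = 0" by (intro determined) auto
    with span_zero show ?case by metis
  next
    case (step n)
    then have "n \<le> l" by simp
    then obtain g where g: "\<theta> (w n) = b n (w n) * g"
      using leading[of n \<theta>] step.prems by (auto elim: dvdE)
    define \<eta> where "\<eta> = \<theta> - fun_scale g (b n)"
    have "\<eta> \<in> M"
      unfolding \<eta>_def using sub step.prems(1) mem[OF \<open>n \<le> l\<close>]
      by (intro subspace_diff subspace_scale)
    moreover have "\<eta> (w j) = 0" if "j < Suc n" for j
    proof (cases "j = n")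
      case False
      with that show ?thesis
        using step.prems(2) triangular[of j n] \<open>n \<le> l\<close> by (simp add: \<eta>_def fun_scale_def)
    qed (simp add: \<eta>_def fun_scale_def g mult.commute)
    ultimately have "\<eta> \<in> span (b ` {0..l})" by (rule step.IH)
    moreover have "b n \<in> span (b ` {0..l})" using \<open>n \<le> l\<close> by (intro span_base) auto
    ultimately have "\<eta> + fun_scale g (b n) \<in> span (b ` {0..l})"
      by (intro span_add span_scale)
    then show ?case by (simp add: \<eta>_def)
  qed
  show "span (b ` {0..l}) = M"
  proof
    show "span (b ` {0..l}) \<subseteq> M" using mem sub by (intro span_minimal) auto
    show "M \<subseteq> span (b ` {0..l})" using in_span[of 0] by auto
  qed
next
  fix c :: "nat \<Rightarrow> 'r" and j
  assume rel: "(\<Sum>k\<in>{0..l}. fun_scale (c k) (b k)) = 0" and "j \<in> {0..l}"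
  then have "j \<le> l" by simp
  then show "c j = 0"
  proof (induction j rule: less_induct)
    case (less j)
    have "0 = (\<Sum>k\<in>{0..l}. fun_scale (c k) (b k)) (w j)" by (simp add: rel)
    also have "\<dots> = (\<Sum>k\<in>{0..l}. c k * b k (w j))" by (rule sum_fun_scale_apply)
    also have "\<dots> = (\<Sum>k\<in>{0..l}. if k = j then c j * b j (w j) else 0)"
    proof (rule sum.cong)
      fix k assume "k \<in> {0..l}"
      then show "c k * b k (w j) = (if k = j then c j * b j (w j) else 0)"
        using less.IH[of k] less.prems triangular[of j k] by (cases k j rule: linorder_cases) auto
    qed simp
    also have "\<dots> = c j * b j (w j)" using less.prems by simp
    finally show ?case using regular[OF less.prems, of "c j"] by simp
  qed
qed simp


section \<open>Linear forms and hyperplanes\<close>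

lemma form_eq_0_imp_zero:
  fixes scl :: "'k::field \<Rightarrow> 'v::ab_group_add \<Rightarrow> 'v" and u :: "'i::finite \<Rightarrow> 'v \<Rightarrow> 'k"
  assumes basis: "is_basis_family fun_scale (dual_space scl) UNIV u" and zero: "\<And>p. form u c p = 0"
  shows "c i = 0"
proof -
  interpret module "fun_scale :: 'k \<Rightarrow> ('v \<Rightarrow> 'k) \<Rightarrow> 'v \<Rightarrow> 'k" by (rule module_fun_scale)
  have inj: "inj u" and indep: "independent (range u)"
    using basis by (auto simp: is_basis_family_def)
  have "(\<Sum>i\<in>UNIV. fun_scale (c i) (u i)) = 0"
    using zero by (intro ext) (simp add: sum_fun_scale_apply form_def)
  then have "(\<Sum>f\<in>range u. fun_scale (c (inv u f)) f) = 0"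
    by (simp add: sum.reindex[OF inj] inv_f_f[OF inj])
  then have "c (inv u (u i)) = 0"
    by (intro independentD[OF indep, of "range u" "\<lambda>f. c (inv u f)" "u i"]) auto
  then show ?thesis by (simp add: inv_f_f[OF inj])
qed

lemma basis_form_linear:
  fixes scl :: "'k::field \<Rightarrow> 'v::ab_group_add \<Rightarrow> 'v" and u :: "'i::finite \<Rightarrow> 'v \<Rightarrow> 'k"
  assumes basis: "is_basis_family fun_scale (dual_space scl) UNIV u"
  shows "form u c (p + q) = form u c p + form u c q" "form u c (scl r p) = r * form u c p"
proof -
  interpret module "fun_scale :: 'k \<Rightarrow> ('v \<Rightarrow> 'k) \<Rightarrow> 'v \<Rightarrow> 'k" by (rule module_fun_scale)
  have "u i \<in> dual_space scl" for i
    using basis span_base[of "u i" "range u"] by (auto simp: is_basis_family_def)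
  then have "u i (p + q) = u i p + u i q" "u i (scl r p) = r * u i p" for i p q r
    by (auto simp: dual_space_def Vector_Spaces.linear_iff)
  then show "form u c (p + q) = form u c p + form u c q" "form u c (scl r p) = r * form u c p"
    by (simp_all add: form_def sum.distrib sum_distrib_left algebra_simps)
qed

text \<open>If \<open>p\<close> lies outside the hyperplane, every vector is a multiple of \<open>p\<close> plus a vector of the
  hyperplane, so a form vanishing there is determined by its value at \<open>p\<close>.\<close>

lemma same_hyperplane_imp_proportional:
  fixes scl :: "'k::field \<Rightarrow> 'v::ab_group_add \<Rightarrow> 'v" and u :: "'i::finite \<Rightarrow> 'v \<Rightarrow> 'k"
  assumes basis: "is_basis_family fun_scale (dual_space scl) UNIV u"
    and same: "hyperplane (form u c) = hyperplane (form u d)"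
  obtains r where "c = (\<lambda>i. r * d i)"
proof -
  have kernel: "form u c p = 0 \<longleftrightarrow> form u d p = 0" for p
    using same by (auto simp: hyperplane_def)
  have "\<exists>r. \<forall>p. form u c p = r * form u d p"
  proof (cases "\<forall>p. form u d p = 0")
    case False
    then obtain p where p: "form u d p \<noteq> 0" by blast
    have "form u c q = form u c p / form u d p * form u d q" for q
    proof -
      have "form u d (q + scl (- (form u d q / form u d p)) p) = 0"
        using p by (simp only: basis_form_linear[OF basis]) simp
      then have "form u c (q + scl (- (form u d q / form u d p)) p) = 0" by (simp add: kernel)
      then show ?thesis by (simp only: basis_form_linear[OF basis]) (simp add: mult.commute)
    qed
    then show ?thesis by blast
  qed (simp add: kernel)
  then obtain r where r: "\<And>p. form u c p = r * form u d p" by blast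
  have "form u (\<lambda>i. c i - r * d i) p = 0" for p
    using r[of p] by (simp add: form_def sum_subtractf sum_distrib_left algebra_simps)
  then have "c i - r * d i = 0" for i
    by (rule form_eq_0_imp_zero[OF basis])
  then have "c = (\<lambda>i. r * d i)" by (simp add: fun_eq_iff)
  then show thesis by (rule that)
qed

text \<open>Membership of a hyperplane condition may be tested on one defining form, since a scalar
  factor can be pulled out of both sides of the divisibility.\<close>

lemma all_defining_forms_dvd_iff:
  assumes basis: "is_basis_family fun_scale (dual_space scl) UNIV u" and "\<theta> \<in> Der"
  shows "(\<forall>c. hyperplane (form u c) = hyperplane (form u d) \<longrightarrow> form_poly c dvd \<theta> (form_poly c)) \<longleftrightarrow>
    form_poly d dvd \<theta> (form_poly d)"
proof (intro iffI allI impI)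
  fix c
  assume dvd: "form_poly d dvd \<theta> (form_poly d)" and "hyperplane (form u c) = hyperplane (form u d)"
  then obtain r where "c = (\<lambda>i. r * d i)" using same_hyperplane_imp_proportional[OF basis] by blast
  then have c: "form_poly c = Const r * form_poly d"
    by (simp add: form_poly_def Const_mult sum_distrib_left mult.assoc)
  have "\<theta> (Const r * form_poly d) = Const r * \<theta> (form_poly d)"
    using \<open>\<theta> \<in> Der\<close> unfolding Der_iff by blast
  with dvd show "form_poly c dvd \<theta> (form_poly c)" by (simp add: c mult_dvd_mono)
qed blast

lemma form_delta: "form u (\<lambda>i. if i = a then 1 else 0) = u a"
  and form_poly_delta: "form_poly (\<lambda>i. if i = a then 1 else 0) = Var a"
  by (simp_all add: form_def form_poly_def fun_eq_iff if_distrib[of "\<lambda>c. c * _"] if_distrib[of Const]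
      cong: if_cong)

lemma form_delta_diff:
  "form u (\<lambda>i. (if i = a then 1 else 0) - c * (if i = b then 1 else 0)) = (\<lambda>p. u a p - c * u b p)"
  using fun_cong[OF form_delta[of u a]] fun_cong[OF form_delta[of u b]]
  by (simp only: form_def fun_eq_iff left_diff_distrib sum_subtractf mult.assoc flip: sum_distrib_left)
    simp

lemma form_poly_delta_diff:
  fixes a b :: "'i::finite" and c :: "'k::field"
  shows "form_poly (\<lambda>i. (if i = a then 1 else 0) - c * (if i = b then 1 else 0)) =
    Var a - Const c * Var b"
proof -
  have "(\<Sum>i\<in>UNIV. Const (if i = e then 1 else 0 :: 'k) * Var i) = Var e" for e :: 'i
    using form_poly_delta[of e] unfolding form_poly_def .
  then show ?thesis
    by (simp only: form_poly_def Const_diff Const_mult left_diff_distrib sum_subtractf mult.assoc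
        flip: sum_distrib_left)
qed

lemma subspace_log_derivations:
  fixes u :: "'i::finite \<Rightarrow> 'v \<Rightarrow> 'k::field"
  shows "module.subspace fun_scale (log_derivations u A)"
proof -
  interpret module "fun_scale :: ('i, 'k) mpoly \<Rightarrow> (('i, 'k) mpoly \<Rightarrow> ('i, 'k) mpoly) \<Rightarrow> _"
    by (rule module_fun_scale)
  show ?thesis
    by (rule subspaceI)
      (auto simp: log_derivations_def Der_zero Der_closed_add fun_scale_def
        Der_closed_scale[unfolded fun_scale_def])
qed

lemma in_log_derivations_psi_graphical_iff:
  assumes basis: "is_basis_family fun_scale (dual_space scl) UNIV u"
  shows "\<theta> \<in> log_derivations u (psi_graphical_arrangement V E \<psi> u z x) \<longleftrightarrow> \<theta> \<in> Der \<and>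
    Var z dvd \<theta> (Var z) \<and>
    (\<forall>a b. {a, b} \<in> E \<longrightarrow> Var (x a) - Var (x b) dvd \<theta> (Var (x a)) - \<theta> (Var (x b))) \<and>
    (\<forall>a\<in>V. \<forall>c\<in>\<psi> a. Var (x a) - Const c * Var z dvd \<theta> (Var (x a)) - Const c * \<theta> (Var z))"
proof (cases "\<theta> \<in> Der")
  case True
  let ?log = "\<lambda>H. \<forall>c. hyperplane (form u c) = H \<longrightarrow> form_poly c dvd \<theta> (form_poly c)"
  have scale: "\<theta> (Const c * p) = Const c * \<theta> p" for c p
    using True unfolding Der_iff by blast
  have one: "?log (hyperplane (u a)) \<longleftrightarrow> Var a dvd \<theta> (Var a)" for a
    using all_defining_forms_dvd_iff[OF basis True, of "\<lambda>i. if i = a then 1 else 0"]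
    by (simp only: form_delta form_poly_delta)
  have two: "?log (hyperplane (\<lambda>p. u a p - c * u b p)) \<longleftrightarrow>
      Var a - Const c * Var b dvd \<theta> (Var a) - Const c * \<theta> (Var b)" for a b c
    using all_defining_forms_dvd_iff[OF basis True,
        of "\<lambda>i. (if i = a then 1 else 0) - c * (if i = b then 1 else 0)"]
    by (simp only: form_delta_diff form_poly_delta_diff derivation_diff[OF True] scale)
  have edge: "?log (hyperplane (\<lambda>p. u a p - u b p)) \<longleftrightarrow>
      Var a - Var b dvd \<theta> (Var a) - \<theta> (Var b)" for a b
    using two[of a 1 b] by (simp only: mult_1 Const_1)
  have "\<theta> \<in> log_derivations u (psi_graphical_arrangement V E \<psi> u z x) \<longleftrightarrow>
      ?log (hyperplane (u z)) \<and>
      (\<forall>a b. {a, b} \<in> E \<longrightarrow> ?log (hyperplane (\<lambda>p. u (x a) p - u (x b) p))) \<and>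
      (\<forall>a\<in>V. \<forall>c\<in>\<psi> a. ?log (hyperplane (\<lambda>p. u (x a) p - c * u z p)))"
    using True unfolding log_derivations_def psi_graphical_arrangement_def by blast
  with True show ?thesis by (simp only: one two edge simp_thms)
qed (simp add: log_derivations_def)


section \<open>Weighted elimination orderings\<close>

locale weighted_elimination =
  fixes V :: "'a set" and E :: "'a set set" and \<psi> :: "'a \<Rightarrow> 'k::field set"
    and l :: nat and v :: "nat \<Rightarrow> 'a"
  assumes graph: "simple_graph V E"
    and finite_weights: "\<forall>a\<in>V. finite (\<psi> a)"
    and ordering: "weighted_elimination_ordering V E \<psi> l v"
begin

abbreviation adj :: "nat \<Rightarrow> nat \<Rightarrow> bool" where
  "adj i j \<equiv> {v i, v j} \<in> E"

abbreviation C :: "nat \<Rightarrow> nat set" where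
  "C \<equiv> C_ge E l v"

lemma bij_v: "bij_betw v {1..l} V"
  using ordering by (simp add: weighted_elimination_ordering_def)

lemma v_eq_iff: "i \<in> {1..l} \<Longrightarrow> j \<in> {1..l} \<Longrightarrow> v i = v j \<longleftrightarrow> i = j"
  using bij_v by (auto simp: bij_betw_def inj_on_eq_iff)

lemma edge_vertices:
  assumes "{a, b} \<in> E"
  shows "a \<in> V" "b \<in> V" "a \<noteq> b"
  using graph assms by (fastforce simp: simple_graph_def)+

lemma C_range: "i \<in> C k \<Longrightarrow> k \<le> l \<Longrightarrow> k \<le> i \<and> i \<le> l"
  by (auto simp: C_ge_def)

lemma finite_C: "finite (C k)"
  by (simp add: C_ge_def)

lemma start_in_C: "k \<in> C k"
  by (simp add: C_ge_def)

text \<open>Increasing sequences of indices do not repeat, so every increasing walk is a path. The next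
  two lemmas turn the definition by paths into a closure property and a case distinction on the
  last edge, the only forms in which paths are used afterwards.\<close>

lemma in_C_if_increasing_path:
  assumes "1 \<le> k" "i \<le> l" "sorted_wrt (<) (k # js @ [i])" "successively adj (k # js @ [i])"
  shows "i \<in> C k"
proof -
  have "set (k # js @ [i]) \<subseteq> {1..l}"
    using assms(1-3) by (fastforce simp: sorted_wrt_append)
  then have "inj_on v (set (k # js @ [i]))"
    using bij_v by (meson bij_betw_imp_inj_on inj_on_subset)
  moreover have "distinct (k # js @ [i])"
    using assms(3) strict_sorted_iff by blast
  ultimately have "distinct (map v (k # js @ [i]))"
    by (simp only: distinct_map)
  moreover have "successively (\<lambda>a b. {a, b} \<in> E) (map v (k # js @ [i]))"
    using assms(4) by (simp only: successively_map)
  ultimately have "graph_path E (map v (k # js @ [i]))"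
    unfolding graph_path_def by simp
  moreover have "k < i" using assms(3) by simp
  ultimately show ?thesis using assms(2,3) unfolding C_ge_def by blast
qed

lemma C_step:
  assumes "1 \<le> k" "m \<in> C k" "m < i" "i \<le> l" "adj m i"
  shows "i \<in> C k"
proof (cases "m = k")
  case True
  then show ?thesis using assms by (intro in_C_if_increasing_path[of _ _ "[]"]) auto
next
  case False
  then obtain js where js: "sorted_wrt (<) (k # js @ [m])" "graph_path E (map v (k # js @ [m]))"
    using assms(2) by (auto simp: C_ge_def)
  have "successively adj (k # js @ [m])"
    using js(2) by (simp only: graph_path_def successively_map)
  then have "successively adj ((k # js @ [m]) @ [i])"
    using assms(5) by (simp only: successively_append_iff) simp
  moreover have "sorted_wrt (<) ((k # js @ [m]) @ [i])"
    using js(1) assms(3) by (auto simp: sorted_wrt_append)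
  ultimately show ?thesis
    using in_C_if_increasing_path[of k i "js @ [m]"] assms(1,4) by simp
qed

lemma C_cases:
  assumes "1 \<le> k" "i \<in> C k"
  obtains "i = k" | m where "m \<in> C k" "m < i" "adj m i"
proof (cases "i = k")
  case False
  then obtain js where js: "sorted_wrt (<) (k # js @ [i])" "graph_path E (map v (k # js @ [i]))"
    and i: "k < i" "i \<le> l"
    using assms(2) by (auto simp: C_ge_def)
  have path: "successively adj (k # js @ [i])"
    using js(2) by (simp only: graph_path_def successively_map)
  show thesis
  proof (cases js rule: rev_cases)
    case Nil
    then show thesis using path i start_in_C by (intro that(2)[of k]) auto
  next
    case (snoc ks m)
    have "successively adj ((k # ks @ [m]) @ [i])" using path snoc by simp
    then have split: "successively adj (k # ks @ [m])" "adj m i"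
      by (simp_all only: successively_append_iff) simp
    have sorted: "sorted_wrt (<) (k # ks @ [m])" "m < i"
      using js(1) snoc by (auto simp: sorted_wrt_append)
    then have "m \<in> C k"
      using assms(1) i split(1) by (intro in_C_if_increasing_path[of _ _ ks]) auto
    then show thesis using sorted(2) split(2) by (rule that(2))
  qed
qed (rule that(1))

lemma weights_subset:
  assumes "1 \<le> k" "k \<le> l" "i \<in> C k"
  shows "\<psi> (v i) \<subseteq> \<psi> (v k)"
  using assms(3)
proof (induction i rule: less_induct)
  case (less i)
  from \<open>1 \<le> k\<close> less.prems show ?case
  proof (cases rule: C_cases)
    case (2 m)
    have "\<psi> (v i) \<subseteq> \<psi> (v m)"
      using ordering 2 C_range[of m k] C_range[of i k] assms less.prems
      unfolding weighted_elimination_ordering_def by auto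
    with less.IH[of m] 2 show ?thesis by blast
  qed simp
qed

lemma earlier_neighbors_adjacent:
  assumes "adj i j" "adj m j" "1 \<le> i" "i < j" "1 \<le> m" "m < j" "j \<le> l" "i \<noteq> m"
  shows "adj i m"
proof -
  let ?F = "induced_edges E (v ` {1..j})"
  have "simplicial ?F (v j)"
    using ordering assms by (simp add: weighted_elimination_ordering_def)
  moreover have "v i \<in> neighbors ?F (v j)" "v m \<in> neighbors ?F (v j)"
    using assms by (auto simp: neighbors_def induced_edges_def insert_commute)
  moreover have "v i \<noteq> v m" using assms v_eq_iff[of i m] by simp
  ultimately show ?thesis
    by (auto simp: simplicial_def complete_graph_def induced_edges_def)
qed

text \<open>Let \<open>m\<close> precede \<open>j\<close> on a path from \<open>k\<close>. Both \<open>i\<close> and \<open>m\<close> are earlier neighbours of \<open>j\<close>,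
  hence adjacent; \<open>m < i\<close> would put \<open>i\<close> into \<open>C k\<close>, so \<open>i\<close> is an earlier neighbour of \<open>m\<close> as well,
  and the argument repeats with \<open>m\<close> in place of \<open>j\<close> until it reaches \<open>k\<close>.\<close>

lemma outside_neighbor_in_E_lt:
  assumes "1 \<le> k" "k \<le> l" "j \<in> C k" "1 \<le> i" "i < j" "adj i j" "i \<notin> C k"
  shows "i \<in> E_lt E v k"
  using assms(3,5,6)
proof (induction j rule: less_induct)
  case (less j)
  from \<open>1 \<le> k\<close> less.prems(1) show ?case
  proof (cases rule: C_cases)
    case 1
    with less.prems assms(4) show ?thesis by (simp add: E_lt_def)
  next
    case (2 m)
    have range: "k \<le> m" "j \<le> l" "m \<le> l"
      using C_range[OF 2(1) assms(2)] C_range[OF less.prems(1) assms(2)] by auto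
    have "i \<noteq> m" using 2 assms(7) by blast
    then have "adj i m"
      using earlier_neighbors_adjacent[of i j m] less.prems 2 range assms(1,4) by linarith
    moreover have "\<not> m < i"
    proof
      assume "m < i"
      moreover have "adj m i" using \<open>adj i m\<close> by (simp add: insert_commute)
      ultimately have "i \<in> C k" using C_step[OF assms(1) 2(1), of i] less.prems(2) range by simp
      with assms(7) show False ..
    qed
    ultimately show ?thesis using less.IH[of m] 2 \<open>i \<noteq> m\<close> by linarith
  qed
qed

end


section \<open>The derivations of a weighted elimination ordering\<close>

locale weighted_elimination_coordinates = weighted_elimination V E \<psi> l v
  for V :: "'a set" and E :: "'a set set" and \<psi> :: "'a \<Rightarrow> 'k::field set"
    and l :: nat and v :: "nat \<Rightarrow> 'a" +
  fixes z :: "'i::finite" and x :: "'a \<Rightarrow> 'i"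
  assumes bij_x: "bij_betw x V (UNIV - {z})"
begin

abbreviation X :: "nat \<Rightarrow> ('i, 'k) mpoly" where
  "X i \<equiv> Var (x (v i))"

lemma bij_xv: "bij_betw (\<lambda>i. x (v i)) {1..l} (UNIV - {z})"
  using bij_betw_trans[OF bij_v bij_x] by (simp add: comp_def)

lemma xv_eq_iff: "i \<in> {1..l} \<Longrightarrow> j \<in> {1..l} \<Longrightarrow> x (v i) = x (v j) \<longleftrightarrow> i = j"
  using inj_on_eq_iff[OF bij_betw_imp_inj_on[OF bij_xv]] .

lemma xv_neq_z: "i \<in> {1..l} \<Longrightarrow> x (v i) \<noteq> z"
  using bij_betw_apply[OF bij_xv, of i] by simp

lemma index_cases:
  obtains "j = z" | i where "i \<in> {1..l}" "j = x (v i)"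
proof (cases "j = z")
  case False
  then have "j \<in> (\<lambda>i. x (v i)) ` {1..l}" using bij_betw_imp_surj_on[OF bij_xv] by simp
  then show thesis using that(2) by (elim imageE) simp
qed (rule that(1))

lemma finite_psi: "i \<in> {1..l} \<Longrightarrow> finite (\<psi> (v i))"
  using finite_weights bij_betw_apply[OF bij_v] by blast

definition coefficient :: "nat \<Rightarrow> nat \<Rightarrow> ('i, 'k) mpoly" where
  "coefficient k i = (\<Prod>j\<in>E_lt E v k. X j - X i) * (\<Prod>c\<in>\<psi> (v k). X i - Const c * Var z)"

lemma theta_eq: "theta E \<psi> l v z x k = (\<lambda>p. \<Sum>i\<in>C k. coefficient k i * partial (x (v i)) p)"
  by (simp add: theta_def coefficient_def)

lemma theta_in_Der: "theta E \<psi> l v z x k \<in> Der"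
  unfolding theta_eq by (rule sum_partial_in_Der)

lemma theta_Var_z:
  assumes "k \<in> {1..l}"
  shows "theta E \<psi> l v z x k (Var z) = 0"
  unfolding theta_eq
proof (rule sum.neutral, rule ballI)
  fix i assume "i \<in> C k"
  then have "x (v i) \<noteq> z" using C_range[of i k] assms by (intro xv_neq_z) auto
  then show "coefficient k i * partial (x (v i)) (Var z) = 0" by (simp add: partial_Var)
qed

lemma theta_X:
  assumes "k \<in> {1..l}" "i \<in> {1..l}"
  shows "theta E \<psi> l v z x k (X i) = (if i \<in> C k then coefficient k i else 0)"
proof -
  have "theta E \<psi> l v z x k (X i) = (\<Sum>j\<in>C k. if j = i then coefficient k i else 0)"
    unfolding theta_eq
  proof (rule sum.cong)
    fix j assume "j \<in> C k"
    then have "j \<in> {1..l}" using C_range[of j k] assms(1) by auto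
    then show "coefficient k j * partial (x (v j)) (X i) = (if j = i then coefficient k i else 0)"
      using xv_eq_iff[OF _ assms(2)] by (simp add: partial_Var)
  qed simp
  then show ?thesis by (simp add: finite_C)
qed

lemma theta_Euler_eq: "theta_Euler l v z x = (\<lambda>p :: ('i, 'k) mpoly. \<Sum>i\<in>UNIV. Var i * partial i p)"
proof
  fix p :: "('i, 'k) mpoly"
  have "(\<Sum>i\<in>{1..l}. Var (x (v i)) * partial (x (v i)) p) = (\<Sum>i\<in>UNIV - {z}. Var i * partial i p)"
    using sum.reindex_bij_betw[OF bij_xv, of "\<lambda>i. Var i * partial i p"] by simp
  then show "theta_Euler l v z x p = (\<Sum>i\<in>UNIV. Var i * partial i p)"
    by (simp add: theta_Euler_def sum.remove[of UNIV z] add.commute)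
qed

lemma theta_Euler_in_Der: "theta_Euler l v z x \<in> (Der :: (('i, 'k) mpoly \<Rightarrow> _) set)"
  unfolding theta_Euler_eq by (rule sum_partial_in_Der)

lemma theta_Euler_Var: "theta_Euler l v z x (Var i) = (Var i :: ('i, 'k) mpoly)"
  by (simp add: theta_Euler_eq partial_Var if_distrib[of "\<lambda>c. _ * c"] cong: if_cong)

lemma homogeneous_theta_Euler: "homogeneous_derivation 1 (theta_Euler l v z x :: ('i, 'k) mpoly \<Rightarrow> _)"
  unfolding homogeneous_derivation_def
proof (intro conjI exI[of _ Var] allI)
qed (fact theta_Euler_in_Der homogeneous_Var theta_Euler_eq)+

lemma homogeneous_coefficient:
  "homogeneous (card (E_lt E v k) + card (\<psi> (v k))) (coefficient k i)"
  unfolding coefficient_def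
  by (intro homogeneous_mult homogeneous_prod_linear homogeneous_diff homogeneous_Var
      homogeneous_Const_mult_Var)

text \<open>The sum defining \<open>\<theta>\<^sub>k\<close> runs over vertices in \<open>C k\<close>, the notion of homogeneity over all
  coordinates; the coefficients are therefore recovered as values at the variables.\<close>

lemma homogeneous_theta:
  assumes "k \<in> {1..l}"
  shows "homogeneous_derivation (card (E_lt E v k) + card (\<psi> (v k))) (theta E \<psi> l v z x k)"
  unfolding homogeneous_derivation_def
proof (intro conjI exI[of _ "\<lambda>j. theta E \<psi> l v z x k (Var j)"] allI)
  show "homogeneous (card (E_lt E v k) + card (\<psi> (v k))) (theta E \<psi> l v z x k (Var j))" for j
  proof (cases j rule: index_cases)
    case 1
    then show ?thesis using theta_Var_z[OF assms] by simp
  next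
    case (2 i)
    then show ?thesis using theta_X[OF assms 2(1)] homogeneous_coefficient by simp
  qed
  show "theta E \<psi> l v z x k = (\<lambda>p. \<Sum>i\<in>UNIV. theta E \<psi> l v z x k (Var i) * partial i p)"
  proof (rule derivation_eqI[OF theta_in_Der])
    show "(\<lambda>p. \<Sum>i\<in>UNIV. theta E \<psi> l v z x k (Var i) * partial i p) \<in> Der"
      by (rule sum_partial_in_Der)
    show "theta E \<psi> l v z x k (Var j) = (\<Sum>i\<in>UNIV. theta E \<psi> l v z x k (Var i) * partial i (Var j))"
      for j by (simp add: partial_Var if_distrib[of "\<lambda>c. _ * c"] cong: if_cong)
  qed
qed (rule theta_in_Der)

text \<open>Both coefficients are values of the polynomial
  \<open>(\<Prod>m\<in>E\<^sub><\<^sub>k. x\<^sub>m - t) (\<Prod>a\<in>\<psi>(v\<^sub>k). t - a z)\<close> in \<open>t\<close>, at \<open>t = x\<^sub>i\<close> and \<open>t = x\<^sub>j\<close>.\<close>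

lemma diff_dvd_coefficient_diff: "X i - X j dvd coefficient k i - coefficient k j"
proof -
  have rev: "X i - X j dvd X j - X i" by (subst diff_dvd_commute) (rule dvd_refl)
  have "X i - X j dvd (\<Prod>m\<in>E_lt E v k. X m - X i) - (\<Prod>m\<in>E_lt E v k. X m - X j)"
    using rev by (intro dvd_prod_diff) simp
  moreover have "X i - X j dvd (\<Prod>c\<in>\<psi> (v k). X i - Const c * Var z) -
      (\<Prod>c\<in>\<psi> (v k). X j - Const c * Var z)"
    by (intro dvd_prod_diff) simp
  ultimately have "X i - X j dvd
      ((\<Prod>m\<in>E_lt E v k. X m - X i) - (\<Prod>m\<in>E_lt E v k. X m - X j)) * (\<Prod>c\<in>\<psi> (v k). X i - Const c * Var z) +
      (\<Prod>m\<in>E_lt E v k. X m - X j) * ((\<Prod>c\<in>\<psi> (v k). X i - Const c * Var z) -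
      (\<Prod>c\<in>\<psi> (v k). X j - Const c * Var z))"
    by (intro dvd_add dvd_mult dvd_mult2)
  then show ?thesis by (simp add: coefficient_def algebra_simps)
qed

lemma finite_E_lt: "finite (E_lt E v k)"
  by (rule finite_subset[of _ "{..k}"]) (auto simp: E_lt_def)

lemma theta_dvd_edge:
  assumes k: "k \<in> {1..l}" and i: "i \<in> {1..l}" and j: "j \<in> {1..l}" and "i < j" "adj i j"
  shows "X i - X j dvd theta E \<psi> l v z x k (X i) - theta E \<psi> l v z x k (X j)"
proof -
  consider "i \<in> C k" "j \<in> C k" | "i \<notin> C k" "j \<in> C k" | "i \<notin> C k" "j \<notin> C k"
    using C_step[of k i j] assms by auto
  then show ?thesis
  proof cases
    case 1
    with k i j show ?thesis by (simp add: theta_X diff_dvd_coefficient_diff del: atLeastAtMost_iff)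
  next
    case 2
    then have "i \<in> E_lt E v k" using outside_neighbor_in_E_lt[of k j i] assms by auto
    then have "X i - X j dvd (\<Prod>m\<in>E_lt E v k. X m - X j)"
      using finite_E_lt by (rule dvd_prodI[rotated])
    with 2 k i j show ?thesis by (simp add: theta_X coefficient_def del: atLeastAtMost_iff)
  next
    case 3
    with k i j show ?thesis by (simp add: theta_X del: atLeastAtMost_iff)
  qed
qed

lemma theta_dvd_weight:
  assumes k: "k \<in> {1..l}" and i: "i \<in> {1..l}" and c: "c \<in> \<psi> (v i)"
  shows "X i - Const c * Var z dvd theta E \<psi> l v z x k (X i)"
proof (cases "i \<in> C k")
  case True
  then have "c \<in> \<psi> (v k)" using weights_subset[of k i] k c by auto
  then have "X i - Const c * Var z dvd (\<Prod>c\<in>\<psi> (v k). X i - Const c * Var z)"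
    using finite_psi[OF k] by (rule dvd_prodI[rotated])
  with True k i show ?thesis by (simp add: theta_X coefficient_def del: atLeastAtMost_iff)
qed (use k i in \<open>simp add: theta_X del: atLeastAtMost_iff\<close>)

lemma leading_coefficient_nonzero:
  assumes "k \<in> {1..l}"
  shows "coefficient k k \<noteq> 0"
proof -
  have "(\<Prod>j\<in>E_lt E v k. X j - X k) \<noteq> 0"
  proof (rule mpoly_prod_nonzero)
    fix j assume "j \<in> E_lt E v k"
    then show "X j - X k \<noteq> 0" using xv_eq_iff[of j k] assms by (auto simp: E_lt_def)
  qed
  moreover have "(\<Prod>c\<in>\<psi> (v k). X k - Const c * Var z) \<noteq> 0"
    using xv_neq_z[OF assms] by (intro mpoly_prod_nonzero) (simp add: Var_neq_Const_mult_Var)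
  ultimately show ?thesis unfolding coefficient_def using mpoly_no_zero_divisors by blast
qed

text \<open>As polynomials in \<open>x\<^sub>k\<close>, the given divisors have the roots \<open>x\<^sub>j\<close> and \<open>a z\<close>. These are
  pairwise different, so the factor theorem for several roots applies.\<close>

lemma leading_coefficient_dvd:
  assumes k: "k \<in> {1..l}"
    and edges: "\<And>j. j \<in> E_lt E v k \<Longrightarrow> X j - X k dvd p"
    and weights: "\<And>c. c \<in> \<psi> (v k) \<Longrightarrow> X k - Const c * Var z dvd p"
  shows "coefficient k k dvd p"
proof -
  let ?W = "(\<lambda>c. Const c * Var z) ` \<psi> (v k)"
  let ?N = "X ` E_lt E v k"
  have E_range: "E_lt E v k \<subseteq> {1..l}" "k \<notin> E_lt E v k"
    using k by (auto simp: E_lt_def)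
  have E_neq: "x (v j) \<noteq> x (v k)" if "j \<in> E_lt E v k" for j
    using that E_range xv_eq_iff[of j k] k by blast
  have flip: "X k - X j dvd X j - X k" "X j - X k dvd X k - X j" for j
    by (subst diff_dvd_commute, rule dvd_refl)+
  have "(\<Prod>t\<in>?N \<union> ?W. X k - t) dvd p"
  proof (rule prod_root_factors_dvd)
    show "finite (?N \<union> ?W)" using finite_E_lt finite_psi[OF k] by simp
    fix t assume t: "t \<in> ?N \<union> ?W"
    then show "X k - t dvd p"
      using edges weights by (auto simp: diff_dvd_commute[of "X k" "X _" p])
    fix s
    show "substitute (x (v k)) s t = t"
      using t E_neq xv_neq_z[OF k] by (auto simp: substitute_Var substitute_mult)
  qed
  moreover have "(\<Prod>t\<in>?N \<union> ?W. X k - t) =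
      (\<Prod>j\<in>E_lt E v k. X k - X j) * (\<Prod>c\<in>\<psi> (v k). X k - Const c * Var z)"
  proof -
    have disjoint: "?N \<inter> ?W = {}"
      using xv_neq_z E_range(1) by (auto simp: Var_neq_Const_mult_Var)
    have "inj_on X (E_lt E v k)"
      using xv_eq_iff E_range(1) by (intro inj_onI) (auto simp: subset_iff)
    moreover have "inj_on (\<lambda>c. Const c * Var z) (\<psi> (v k))"
      by (rule inj_onI) (simp add: Const_mult_Var_eq_iff)
    ultimately show ?thesis
      using finite_E_lt finite_psi[OF k] disjoint by (simp add: prod.union_disjoint prod.reindex)
  qed
  ultimately have "(\<Prod>j\<in>E_lt E v k. X k - X j) * (\<Prod>c\<in>\<psi> (v k). X k - Const c * Var z) dvd p"
    by simp
  moreover have "coefficient k k dvd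
      (\<Prod>j\<in>E_lt E v k. X k - X j) * (\<Prod>c\<in>\<psi> (v k). X k - Const c * Var z)"
    unfolding coefficient_def using flip by (intro mult_dvd_mono prod_dvd_prod dvd_refl)
  ultimately show ?thesis by (rule dvd_trans[rotated])
qed

end

theorem theorem4p1:
  fixes scl :: "'k::field \<Rightarrow> 'v::ab_group_add \<Rightarrow> 'v"
    and u :: "'i::finite \<Rightarrow> 'v \<Rightarrow> 'k"
    and z :: 'i
    and x :: "'a \<Rightarrow> 'i"
    and V :: "'a set"
    and E :: "'a set set"
    and \<psi> :: "'a \<Rightarrow> 'k set"
    and l :: nat
    and v :: "nat \<Rightarrow> 'a"
  assumes graph: "simple_graph V E" "card V = l"
    and psi: "\<forall>a\<in>V. finite (\<psi> a)"
    and space: "vector_space scl" "vector_space.dim scl UNIV = l + 1"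
    and coordinates: "is_basis_family fun_scale (dual_space scl) UNIV u"
      "bij_betw x V (UNIV - {z})"
    and ordering: "weighted_elimination_ordering V E \<psi> l v"
  defines "\<Theta> \<equiv> (\<lambda>k. if k = 0 then theta_Euler l v z x else theta E \<psi> l v z x k)"
  shows "(\<forall>k\<in>{0..l}. \<exists>d. homogeneous_derivation d (\<Theta> k)) \<and>
    is_basis_family fun_scale
      (log_derivations u (psi_graphical_arrangement V E \<psi> u z x)) {0..l} \<Theta>"
proof
  interpret weighted_elimination_coordinates V E \<psi> l v z x
    by unfold_locales (use assms in auto)
  let ?M = "log_derivations u (psi_graphical_arrangement V E \<psi> u z x)"
  define w :: "nat \<Rightarrow> ('i, 'k) mpoly" where "w j = Var (if j = 0 then z else x (v j))" for j
  have w_simps: "w 0 = Var z" "j \<in> {1..l} \<Longrightarrow> w j = X j" for j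
    by (auto simp: w_def)
  have \<Theta>_simps: "\<Theta> 0 = theta_Euler l v z x" "k \<in> {1..l} \<Longrightarrow> \<Theta> k = theta E \<psi> l v z x k" for k
    by (auto simp: \<Theta>_def)
  have index0: "k = 0 \<or> k \<in> {1..l}" if "k \<le> l" for k
    using that by auto
  show "\<forall>k\<in>{0..l}. \<exists>d. homogeneous_derivation d (\<Theta> k)"
    using homogeneous_theta_Euler homogeneous_theta index0 \<Theta>_simps by (metis atLeastAtMost_iff)
  \<comment> \<open>Edges are unordered; it suffices to test each of them from its smaller to its larger end.\<close>
  have in_M_iff: "\<theta> \<in> ?M \<longleftrightarrow> \<theta> \<in> Der \<and> Var z dvd \<theta> (Var z) \<and>
      (\<forall>j\<in>{1..l}. \<forall>i\<in>{1..l}. i < j \<longrightarrow> adj i j \<longrightarrow> X i - X j dvd \<theta> (X i) - \<theta> (X j)) \<and>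
      (\<forall>i\<in>{1..l}. \<forall>c\<in>\<psi> (v i). X i - Const c * Var z dvd \<theta> (X i) - Const c * \<theta> (Var z))" for \<theta>
  proof -
    have V: "V = v ` {1..l}" using bij_v by (simp add: bij_betw_def)
    have flip: "X i - X j dvd p - q \<longleftrightarrow> X j - X i dvd q - p" for i j and p q :: "('i, 'k) mpoly"
      using minus_dvd_iff[of "X i - X j" "p - q"] dvd_minus_iff[of "X j - X i" "p - q"] by simp
    have edges: "(\<forall>a b. {a, b} \<in> E \<longrightarrow> Var (x a) - Var (x b) dvd \<theta> (Var (x a)) - \<theta> (Var (x b))) \<longleftrightarrow>
        (\<forall>j\<in>{1..l}. \<forall>i\<in>{1..l}. i < j \<longrightarrow> adj i j \<longrightarrow> X i - X j dvd \<theta> (X i) - \<theta> (X j))"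
      (is "?all \<longleftrightarrow> ?ordered")
    proof
      assume ordered: ?ordered
      show ?all
      proof (intro allI impI)
        fix a b assume ab: "{a, b} \<in> E"
        obtain i where i: "i \<in> {1..l}" "a = v i" using edge_vertices(1)[OF ab] V by blast
        obtain j where j: "j \<in> {1..l}" "b = v j" using edge_vertices(2)[OF ab] V by blast
        have "i \<noteq> j" using edge_vertices(3)[OF ab] i j by blast
        then consider "i < j" | "j < i" by linarith
        then show "Var (x a) - Var (x b) dvd \<theta> (Var (x a)) - \<theta> (Var (x b))"
        proof cases
          case 1
          then show ?thesis using ordered i j ab by blast
        next
          case 2
          have "adj j i" using ab i j by (simp add: insert_commute)
          with 2 have "X j - X i dvd \<theta> (X j) - \<theta> (X i)" using ordered i j by blast
          then show ?thesis using flip[of i j] i j by blast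
        qed
      qed
    qed blast
    have weights: "(\<forall>a\<in>V. P a) \<longleftrightarrow> (\<forall>i\<in>{1..l}. P (v i))" for P by (simp only: V ball_simps)
    show ?thesis
      by (simp only: in_log_derivations_psi_graphical_iff[OF coordinates(1)] edges weights)
  qed
  show "is_basis_family fun_scale ?M {0..l} \<Theta>"
  proof (rule triangular_is_basis_family[of _ _ _ w])
    show "module.subspace fun_scale ?M" by (rule subspace_log_derivations)
  next
    fix k assume "k \<le> l"
    then consider "k = 0" | "k \<in> {1..l}" using index0 by blast
    then show "\<Theta> k \<in> ?M"
    proof cases
      case 1
      then show ?thesis by (simp add: \<Theta>_simps in_M_iff theta_Euler_in_Der theta_Euler_Var)
    next
      case 2
      then show ?thesis
        by (simp add: \<Theta>_simps in_M_iff theta_in_Der theta_Var_z theta_dvd_edge theta_dvd_weight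
            del: atLeastAtMost_iff)
    qed
  next
    fix j k :: nat assume "j < k" "k \<le> l"
    then have k: "k \<in> {1..l}" and "j \<le> l" by auto
    from index0[OF this(2)] show "\<Theta> k (w j) = 0"
    proof
      assume "j \<in> {1..l}"
      moreover have "j \<notin> C k" using C_range[of j k] \<open>j < k\<close> \<open>k \<le> l\<close> by auto
      ultimately show ?thesis using k by (simp add: \<Theta>_simps w_simps theta_X del: atLeastAtMost_iff)
    qed (use k in \<open>simp add: \<Theta>_simps w_simps theta_Var_z del: atLeastAtMost_iff\<close>)
  next
    fix k and g :: "('i, 'k) mpoly"
    assume "k \<le> l" and zero: "g * \<Theta> k (w k) = 0"
    have "\<Theta> k (w k) \<noteq> 0"
    proof (cases "k = 0")
      case True
      then show ?thesis by (simp add: \<Theta>_simps w_simps theta_Euler_Var Var_nonzero)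
    next
      case False
      with \<open>k \<le> l\<close> have "k \<in> {1..l}" by simp
      then show ?thesis
        by (simp add: \<Theta>_simps w_simps theta_X start_in_C leading_coefficient_nonzero
            del: atLeastAtMost_iff)
    qed
    with zero show "g = 0" using mpoly_no_zero_divisors by blast
  next
    fix k \<theta> assume "k \<le> l" "\<theta> \<in> ?M" and vanish: "\<And>j. j < k \<Longrightarrow> \<theta> (w j) = 0"
    show "\<Theta> k (w k) dvd \<theta> (w k)"
    proof (cases "k = 0")
      case True
      with \<open>\<theta> \<in> ?M\<close> show ?thesis by (simp add: \<Theta>_simps w_simps theta_Euler_Var in_M_iff)
    next
      case False
      with \<open>k \<le> l\<close> have k: "k \<in> {1..l}" by simp
      have "coefficient k k dvd \<theta> (X k)"
      proof (rule leading_coefficient_dvd[OF k])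
        fix j assume j: "j \<in> E_lt E v k"
        then have jl: "j \<in> {1..l}" and "j < k" "adj j k" using k by (auto simp: E_lt_def)
        then have "X j - X k dvd \<theta> (X j) - \<theta> (X k)" using \<open>\<theta> \<in> ?M\<close> k by (simp add: in_M_iff)
        moreover have "\<theta> (X j) = 0" using vanish[OF \<open>j < k\<close>] w_simps(2)[OF jl] by simp
        ultimately show "X j - X k dvd \<theta> (X k)" by simp
      next
        fix c assume "c \<in> \<psi> (v k)"
        then have "X k - Const c * Var z dvd \<theta> (X k) - Const c * \<theta> (Var z)"
          using \<open>\<theta> \<in> ?M\<close> k by (simp add: in_M_iff)
        moreover have "\<theta> (Var z) = 0" using vanish[of 0] False w_simps(1) by simp
        ultimately show "X k - Const c * Var z dvd \<theta> (X k)" by simp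
      qed
      with k show ?thesis
        by (simp add: \<Theta>_simps w_simps theta_X start_in_C del: atLeastAtMost_iff)
    qed
  next
    fix \<theta> assume "\<theta> \<in> ?M" and vanish: "\<And>j. j \<le> l \<Longrightarrow> \<theta> (w j) = 0"
    show "\<theta> = 0"
    proof (rule derivation_eqI)
      show "\<theta> \<in> Der" using \<open>\<theta> \<in> ?M\<close> by (simp add: in_M_iff)
      show "0 \<in> Der" by (rule Der_zero)
      show "\<theta> (Var i) = 0 (Var i)" for i
      proof (cases i rule: index_cases)
        case 1
        then show ?thesis using vanish[of 0] by (simp add: w_simps)
      next
        case (2 j)
        then show ?thesis using vanish[of j] w_simps(2)[of j] by simp
      qed
    qed
  qed
qed

end
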